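(* Let $q$ be a prime power with $\mathrm{char}\,\mathbb{F}_q\ne 2,3$ and $q>7$, and let \[ f(X)=aX^2+bX+\frac{1}{X-r}+\frac{1}{X+r}, \] where $a\in\mathbb{F}_q^*$, $b\in\mathbb{F}_q$, $r\in\mathbb{F}_{q^2}\setminus\mathbb{F}_q$ and $r^2\in\mathbb{F}_q$. Then $f$ is not a permutation rational function of $\mathbb{P}^1(\mathbb{F}_q)$.
   Context: $\mathbb{P}^1(\mathbb{F}_q)=\mathbb{F}_q\cup\{\infty\}$ is the projective line over $\mathbb{F}_q$. A rational function $f=P/Q\in\mathbb{F}_q(X)$ ($P,Q$ coprime) defines a map $\mathbb{P}^1(\mathbb{F}_q)\to\mathbb{P}^1(\mathbb{F}_q)$ in the usual way (zeros of $Q$ map to $\infty$, and $f(\infty)$ is the limiting value). A permutation rational function of $\mathbb{P}^1(\mathbb{F}_q)$ is a rational function whose induced map on $\mathbb{P}^1(\mathbb{F}_q)$ is a bijection. *)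

theory Defs
  imports
    "HOL-Library.Cardinality"
    "HOL-Computational_Algebra.Computational_Algebra"
    "Subresultants.More_Homomorphisms"
begin

datatype 'a proj_line = Affine 'a | Infinity

text \<open>The value at infinity is the limiting value: if \<open>degree P \<le> degree Q\<close>, it is the
  coefficient of \<open>P\<close> at \<open>degree Q\<close> (which is \<open>0\<close> if \<open>degree P < degree Q\<close>) over the leading
  coefficient of \<open>Q\<close>.  The pair is meant to be coprime with \<open>Q \<noteq> 0\<close>.\<close>

fun quotient_map :: "'a::field poly \<Rightarrow> 'a poly \<Rightarrow> 'a proj_line \<Rightarrow> 'a proj_line" where
  "quotient_map P Q (Affine x) =
     (if poly Q x = 0 then Infinity else Affine (poly P x / poly Q x))"
| "quotient_map P Q Infinity =
     (if degree P > degree Q then Infinity else Affine (coeff P (degree Q) / lead_coeff Q))"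

definition ratfun_map :: "'a::field poly fract \<Rightarrow> 'a proj_line \<Rightarrow> 'a proj_line" where
  "ratfun_map f = (THE g. \<exists>P Q. Q \<noteq> 0 \<and> coprime P Q \<and> f = Fract P Q \<and> g = quotient_map P Q)"

definition permutation_ratfun :: "'a::field poly fract \<Rightarrow> bool" where
  "permutation_ratfun f \<longleftrightarrow> bij (ratfun_map f)"

definition ratfun_X :: "'a::field poly fract" where
  "ratfun_X = to_fract [:0, 1:]"

definition ratfun_const :: "'a::field \<Rightarrow> 'a poly fract" where
  "ratfun_const c = to_fract [:c:]"

text \<open>The map of fraction fields induced by an injective homomorphism \<open>h\<close> of integral domains.
  For a field embedding \<open>\<phi>\<close>, \<open>map_fract (map_poly \<phi>)\<close> is the inclusion of rational function
  fields.\<close>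

definition map_fract :: "('a::idom \<Rightarrow> 'b::idom) \<Rightarrow> 'a fract \<Rightarrow> 'b fract" where
  "map_fract h f = (THE g. \<exists>p q. q \<noteq> 0 \<and> f = Fract p q \<and> g = Fract (h p) (h q))"

lemma (in inj_idom_hom) map_fract_Fract:
  assumes "q \<noteq> 0"
  shows "map_fract hom (Fract p q) = Fract (hom p) (hom q)"
  unfolding map_fract_def
proof (rule the_equality)
  show "\<exists>p' q'. q' \<noteq> 0 \<and> Fract p q = Fract p' q' \<and> Fract (hom p) (hom q) = Fract (hom p') (hom q')"
    using assms by blast
next
  fix g assume "\<exists>p' q'. q' \<noteq> 0 \<and> Fract p q = Fract p' q' \<and> g = Fract (hom p') (hom q')"
  then obtain p' q' where *: "q' \<noteq> 0" "Fract p q = Fract p' q'" "g = Fract (hom p') (hom q')"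
    by blast
  from * assms have "p * q' = p' * q" by (simp add: eq_fract)
  then have "hom p * hom q' = hom p' * hom q" by (metis hom_mult)
  with * assms show "g = Fract (hom p) (hom q)" by (simp add: eq_fract)
qed

lemma poly_bezout:
  fixes P Q :: "'a::field poly"
  shows "\<exists>u v. u * P + v * Q dvd P \<and> u * P + v * Q dvd Q"
proof (induction "euclidean_size Q" arbitrary: P Q rule: less_induct)
  case less
  show ?case
  proof (cases "Q = 0")
    case True
    then show ?thesis by (intro exI[of _ 1] exI[of _ 0]) simp
  next
    case False
    then have "euclidean_size (P mod Q) < euclidean_size Q" by (rule mod_size_less)
    from less[OF this] obtain u v where uv: "u * Q + v * (P mod Q) dvd Q"
      "u * Q + v * (P mod Q) dvd P mod Q" by blast
    then have "u * Q + v * (P mod Q) dvd P" using dvd_mod_iff by blast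
    moreover have "u * Q + v * (P mod Q) = v * P + (u - v * (P div Q)) * Q"
      by (simp add: minus_div_mult_eq_mod[symmetric] algebra_simps)
    ultimately show ?thesis using uv(1) by metis
  qed
qed

lemma poly_coprime_dvd_mult:
  fixes P Q R :: "'a::field poly"
  assumes "coprime P Q" "Q dvd P * R"
  shows "Q dvd R"
proof -
  obtain u v where "u * P + v * Q dvd P" "u * P + v * Q dvd Q" using poly_bezout by blast
  with assms(1) have "is_unit (u * P + v * Q)" by (rule coprime_common_divisor)
  then obtain w where w: "1 = (u * P + v * Q) * w" by (rule dvdE)
  have "R = R * ((u * P + v * Q) * w)" unfolding w[symmetric] by simp
  also have "\<dots> = u * w * (P * R) + Q * (v * w * R)" by (simp only: algebra_simps)
  finally have "R = u * w * (P * R) + Q * (v * w * R)" .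
  moreover have "Q dvd u * w * (P * R) + Q * (v * w * R)"
    by (intro dvd_add dvd_mult[OF assms(2)] dvd_triv_left)
  ultimately show ?thesis by (simp only:)
qed

lemma ratfun_map_Fract:
  fixes P Q :: "'a::field poly"
  assumes "Q \<noteq> 0" "coprime P Q"
  shows "ratfun_map (Fract P Q) = quotient_map P Q"
  unfolding ratfun_map_def
proof (rule the_equality)
  show "\<exists>P' Q'. Q' \<noteq> 0 \<and> coprime P' Q' \<and> Fract P Q = Fract P' Q' \<and>
          quotient_map P Q = quotient_map P' Q'"
    using assms by blast
next
  fix g assume "\<exists>P' Q'. Q' \<noteq> 0 \<and> coprime P' Q' \<and> Fract P Q = Fract P' Q' \<and> g = quotient_map P' Q'"
  then obtain P' Q' where *: "Q' \<noteq> 0" "coprime P' Q'" "Fract P Q = Fract P' Q'"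
    and g: "g = quotient_map P' Q'" by blast
  from * assms have eq: "P * Q' = P' * Q" by (simp add: eq_fract)
  have "Q dvd P * Q'" unfolding eq by simp
  with assms(2) have "Q dvd Q'" by (rule poly_coprime_dvd_mult)
  then obtain k where k: "Q' = Q * k" by (rule dvdE)
  have "Q' dvd P' * Q" unfolding eq[symmetric] by simp
  with *(2) have "Q' dvd Q" by (rule poly_coprime_dvd_mult)
  then have "Q * k dvd Q * 1" using k by simp
  then have "k dvd 1" unfolding dvd_times_left_cancel_iff[OF assms(1)] .
  then obtain c where c: "k = [:c:]" "c dvd 1" by (rule is_unit_polyE)
  then have "c \<noteq> 0" by auto
  have Q': "Q' = Polynomial.smult c Q" unfolding k c(1) by simp
  with eq have "Polynomial.smult c P * Q = P' * Q" by simp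
  then have P': "P' = Polynomial.smult c P" unfolding mult_right_cancel[OF assms(1)] by (rule sym)
  have "quotient_map P' Q' x = quotient_map P Q x" for x
    using \<open>c \<noteq> 0\<close> by (cases x) (auto simp: P' Q')
  then show "g = quotient_map P Q" using g by blast
qed

text \<open>The function \<open>a X\<^sup>2 + b X + 1 / (X - r) + 1 / (X + r)\<close> has coefficients in the subfield
  as soon as \<open>r\<^sup>2\<close> lies in it.\<close>

lemma ex1_ratfun_over_subfield:
  fixes \<phi> :: "'a::field \<Rightarrow> 'b::field" and a b :: 'a and r :: 'b
  assumes "field_hom \<phi>" and "r ^ 2 \<in> range \<phi>"
  shows "\<exists>!f. map_fract (map_poly \<phi>) f =
       ratfun_const (\<phi> a) * ratfun_X ^ 2 + ratfun_const (\<phi> b) * ratfun_X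
       + 1 / (ratfun_X - ratfun_const r) + 1 / (ratfun_X + ratfun_const r)"
proof -
  interpret field_hom \<phi> by fact
  interpret h: map_poly_inj_idom_hom \<phi> ..
  from assms(2) obtain s where s: "r ^ 2 = \<phi> s" by blast
  define p where "p = [:0, b, a:] * [:-s, 0, 1:] + ([:0, 1:] + [:0, 1:])"
  define u v where "u = [:-r, 1:]" and "v = [:r, 1:]"
  have uv: "map_poly \<phi> [:-s, 0, 1:] = u * v"
    by (simp add: u_def v_def hom_uminus s[symmetric] power2_eq_square)
  have ba: "map_poly \<phi> [:0, b, a:] = [:0, \<phi> b, \<phi> a:]" and X: "map_poly \<phi> [:0, 1:] = [:0, 1:]"
    by (simp_all add: map_poly_pCons_hom)
  have "map_poly \<phi> p = [:0, \<phi> b, \<phi> a:] * (u * v) + ([:0, 1:] + [:0, 1:])"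
    unfolding p_def h.hom_add h.hom_mult uv ba X ..
  moreover have "[:0, 1:] + [:0, 1:] = u + v" by (simp add: u_def v_def)
  ultimately have "map_poly \<phi> p = [:0, \<phi> b, \<phi> a:] * (u * v) + (u + v)" by (simp only:)
  with uv have "map_fract (map_poly \<phi>) (Fract p [:-s, 0, 1:]) =
      Fract ([:0, \<phi> b, \<phi> a:] * (u * v) + (u + v)) (u * v)"
    by (simp add: h.map_fract_Fract)
  also have "\<dots> = to_fract [:0, \<phi> b, \<phi> a:] + 1 / to_fract u + 1 / to_fract v"
  proof -
    have "to_fract u \<noteq> 0" "to_fract v \<noteq> 0" by (simp_all add: u_def v_def)
    then have "(A * (to_fract u * to_fract v) + (to_fract u + to_fract v)) / (to_fract u * to_fract v)
        = A + 1 / to_fract u + 1 / to_fract v" for A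
      by (simp add: field_simps)
    then show ?thesis by (simp only: Fract_conv_to_fract to_fract_add to_fract_mult)
  qed
  also have "to_fract [:0, \<phi> b, \<phi> a:] =
      ratfun_const (\<phi> a) * ratfun_X ^ 2 + ratfun_const (\<phi> b) * ratfun_X"
    by (simp add: ratfun_const_def ratfun_X_def power2_eq_square flip: to_fract_mult to_fract_add)
  also have "to_fract u = ratfun_X - ratfun_const r"
    by (simp add: ratfun_const_def ratfun_X_def u_def flip: to_fract_diff)
  also have "to_fract v = ratfun_X + ratfun_const r"
    by (simp add: ratfun_const_def ratfun_X_def v_def flip: to_fract_add)
  finally have ex: "map_fract (map_poly \<phi>) (Fract p [:-s, 0, 1:]) =
      ratfun_const (\<phi> a) * ratfun_X ^ 2 + ratfun_const (\<phi> b) * ratfun_X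
      + 1 / (ratfun_X - ratfun_const r) + 1 / (ratfun_X + ratfun_const r)" .
  have inj: "f = g" if "map_fract (map_poly \<phi>) f = map_fract (map_poly \<phi>) g" for f g
  proof (cases f)
    case f: (Fract p1 q1)
    show ?thesis
    proof (cases g)
      case g: (Fract p2 q2)
      from that f g have "map_poly \<phi> p1 * map_poly \<phi> q2 = map_poly \<phi> p2 * map_poly \<phi> q1"
        by (simp add: h.map_fract_Fract eq_fract)
      then have "p1 * q2 = p2 * q1" unfolding h.hom_mult[symmetric] by (rule h.injectivity)
      with f g show ?thesis by (simp add: eq_fract)
    qed
  qed
  show ?thesis
  proof (rule ex1I)
    show "map_fract (map_poly \<phi>) (Fract p [:-s, 0, 1:]) =
      ratfun_const (\<phi> a) * ratfun_X ^ 2 + ratfun_const (\<phi> b) * ratfun_X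
      + 1 / (ratfun_X - ratfun_const r) + 1 / (ratfun_X + ratfun_const r)" by (rule ex)
  next
    fix f assume f: "map_fract (map_poly \<phi>) f =
      ratfun_const (\<phi> a) * ratfun_X ^ 2 + ratfun_const (\<phi> b) * ratfun_X
      + 1 / (ratfun_X - ratfun_const r) + 1 / (ratfun_X + ratfun_const r)"
    show "f = Fract p [:-s, 0, 1:]" by (rule inj[OF f[folded ex]])
  qed
qed

end

theory Submission
  imports Defs
begin

text \<open>With \<open>s = r\<^sup>2\<close>, a non-square in the small field, \<open>f\<close> fixes infinity and acts on the affine line
  by \<open>F x = a x\<^sup>2 + b x + 2 x u\<close>, where \<open>u = 1 / (x\<^sup>2 - s)\<close>. If \<open>F\<close> is a bijection, the power sums of
  its values agree with those of all field elements, so \<open>\<Sum>F\<^sup>2 = \<Sum>F\<^sup>3 = 0\<close>. Reducing with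
  \<open>x\<^sup>2 u = 1 + s u\<close>, using that \<open>\<Sum>x\<^sup>k\<close> vanishes for \<open>k \<le> 6 < q - 1\<close>, and writing \<open>T\<close> and \<open>W\<close> for the
  sums of \<open>u\<close> and \<open>u\<^sup>2\<close>, these become \<open>4 (b s T + T + s W) = 0\<close> and
  \<open>12 a (b s\<^sup>2 T + 2 s T + s\<^sup>2 W) = 0\<close>, whence \<open>12 a s T = 0\<close>. But \<open>T\<close> is \<open>1 / r\<close> times the sum of
  \<open>1 / (x - r)\<close>, a logarithmic derivative of \<open>X\<^sup>q - X\<close>, and the derivative of \<open>X\<^sup>q - X\<close> is the nonzero
  constant \<open>-1\<close>.\<close>

section \<open>Power sums over a finite field\<close>

text \<open>Used to discard odd parts: terms odd in the summation variable cancel on the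
  right.\<close>

lemma sum_reflect_double:
  fixes g :: "'a::{finite,ab_group_add} \<Rightarrow> 'b::comm_semiring_1"
  shows "2 * (\<Sum>x\<in>UNIV. g x) = (\<Sum>x\<in>UNIV. g x + g (- x))"
proof -
  have "(\<Sum>x\<in>UNIV. g (- x)) = (\<Sum>x\<in>UNIV. g x)"
    by (rule sum.reindex_bij_witness[of _ uminus uminus]) auto
  then show ?thesis by (simp add: sum.distrib mult_2)
qed

text \<open>Translation by 1 permutes the ring, so adding 1 to every element leaves the total
  unchanged.\<close>

lemma sum_one_finite_ring: "(\<Sum>x::'a::{finite,ring_1}\<in>UNIV. 1) = (0::'a)"
proof -
  have "(\<Sum>x::'a\<in>UNIV. x) = (\<Sum>x\<in>UNIV. x + 1)"
    by (rule sum.reindex_bij_witness[of _ "\<lambda>x. x + 1" "\<lambda>x. x - 1"]) auto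
  then show ?thesis by (simp add: sum.distrib)
qed

text \<open>Since \<open>X^k - 1\<close> has at most \<open>k < q - 1\<close> roots, some nonzero
  \<open>g\<close> has \<open>g ^ k \<noteq> 1\<close>. Multiplication by \<open>g\<close> permutes
  the field and scales the sum by \<open>g ^ k\<close>.\<close>

lemma sum_power_finite_field:
  assumes "0 < k" "k < CARD('a) - 1"
  shows "(\<Sum>x::'a::{finite,field}\<in>UNIV. x ^ k) = 0"
proof -
  define p :: "'a poly" where "p = Polynomial.monom 1 k - 1"
  have p: "poly p x = x ^ k - 1" for x by (simp add: p_def poly_monom)
  have "poly p 0 \<noteq> 0" using assms(1) by (simp add: p zero_power)
  then have "p \<noteq> 0" by auto
  have "degree p \<le> k"
    unfolding p_def by (rule degree_diff_le) (simp_all add: degree_monom_le)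
  with card_poly_roots_bound[OF \<open>p \<noteq> 0\<close>] have "card {x. poly p x = 0} \<le> k" by simp
  moreover have "card (UNIV - {0::'a}) = CARD('a) - 1" by (simp add: card_Diff_singleton)
  ultimately have "\<not> UNIV - {0} \<subseteq> {x. poly p x = 0}"
    using assms(2) card_mono[of "{x. poly p x = 0}" "UNIV - {0}"] by fastforce
  then obtain g :: 'a where g: "g \<noteq> 0" "g ^ k \<noteq> 1" by (auto simp: p)
  have "(\<Sum>x::'a\<in>UNIV. x ^ k) = (\<Sum>x\<in>UNIV. (g * x) ^ k)"
    by (rule sum.reindex_bij_witness[of _ "\<lambda>x. g * x" "\<lambda>x. x / g"]) (use g in auto)
  also have "\<dots> = g ^ k * (\<Sum>x\<in>UNIV. x ^ k)" by (simp add: power_mult_distrib sum_distrib_left)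
  finally show ?thesis using g by (metis mult_cancel_right1)
qed

section \<open>Nonvanishing of \<open>T\<close> by a logarithmic derivative\<close>

text \<open>For \<open>P\<close>, the product of all \<open>X - \<phi> x\<close>, the sum is
  \<open>P'(c) / P(c)\<close>, and \<open>P'\<close> is a nonzero constant.\<close>

lemma sum_inverse_diff_nonzero:
  fixes \<phi> :: "'a::{finite,field} \<Rightarrow> 'b::field"
  assumes "field_hom \<phi>" and "c \<notin> range \<phi>"
  shows "(\<Sum>x\<in>UNIV. 1 / (c - \<phi> x)) \<noteq> 0"
proof -
  interpret field_hom \<phi> by fact
  define P where "P = (\<Prod>x\<in>UNIV. [:- \<phi> x, 1:])"
  define e where "e = (\<Prod>z\<in>UNIV - {0}. z :: 'a)"
  have "e \<noteq> 0" by (simp add: e_def)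
  \<comment> \<open>\<open>P' = \<phi> e\<close>: both have degree below \<open>q\<close> and they agree on the \<open>q\<close> points of \<open>range \<phi>\<close>.\<close>
  have D: "poly (pderiv P) t = (\<Sum>y\<in>UNIV. \<Prod>x\<in>UNIV - {y}. t - \<phi> x)" for t
    by (simp add: P_def pderiv_prod pderiv_pCons poly_sum poly_prod)
  have D_range: "poly (pderiv P) (\<phi> w) = \<phi> e" for w
  proof -
    \<comment> \<open>For \<open>y \<noteq> w\<close> the product contains the zero factor with
      \<open>x = w\<close>.\<close>
    have "poly (pderiv P) (\<phi> w) = (\<Sum>y\<in>UNIV. if y = w then \<Prod>x\<in>UNIV - {w}. \<phi> w - \<phi> x else 0)"
      unfolding D by (rule sum.cong) auto
    also have "\<dots> = (\<Prod>x\<in>UNIV - {w}. \<phi> w - \<phi> x)" by simp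
    also have "\<dots> = \<phi> (\<Prod>x\<in>UNIV - {w}. w - x)" by (simp add: hom_prod hom_minus)
    also have "(\<Prod>x\<in>UNIV - {w}. w - x) = e"
      unfolding e_def by (rule prod.reindex_bij_witness[of _ "\<lambda>x. w - x" "\<lambda>x. w - x"]) auto
    finally show ?thesis .
  qed
  have "degree P = CARD('a)"
    unfolding P_def by (subst degree_prod_eq_sum_degree) auto
  then have "degree (pderiv P) < CARD('a)"
    using degree_pderiv_le[of P] zero_less_card_finite[where 'a = 'a] by linarith
  then have deg: "degree (pderiv P - [:\<phi> e:]) < CARD('a)"
    by (intro degree_diff_less) auto
  have "pderiv P - [:\<phi> e:] = 0"
  proof (rule ccontr)
    assume nz: "pderiv P - [:\<phi> e:] \<noteq> 0"
    have "CARD('a) = card (range \<phi>)" by (simp add: card_image inj_f)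
    also have "\<dots> \<le> card {x. poly (pderiv P - [:\<phi> e:]) x = 0}"
      by (rule card_mono[OF poly_roots_finite[OF nz]]) (auto simp: D_range)
    also have "\<dots> \<le> degree (pderiv P - [:\<phi> e:])" by (rule card_poly_roots_bound[OF nz])
    finally show False using deg by simp
  qed
  then have Dc: "poly (pderiv P) c = \<phi> e" by simp
  have nz: "c - \<phi> x \<noteq> 0" for x using assms(2) by auto
  have "(\<Prod>x\<in>UNIV. c - \<phi> x) * (\<Sum>y\<in>UNIV. 1 / (c - \<phi> y)) = poly (pderiv P) c"
    unfolding D sum_distrib_left
  proof (rule sum.cong)
    fix y
    show "(\<Prod>x\<in>UNIV. c - \<phi> x) * (1 / (c - \<phi> y)) = (\<Prod>x\<in>UNIV - {y}. c - \<phi> x)"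
      using nz[of y] by (simp add: prod.remove[of UNIV y])
  qed simp
  then show ?thesis using Dc \<open>e \<noteq> 0\<close> by auto
qed

text \<open>By partial fractions, pairing \<open>x\<close> with \<open>- x\<close> turns the sum of
  \<open>1 / (r - \<phi> x)\<close> into a multiple of the image of this one.\<close>

lemma sum_inverse_square_diff_nonzero:
  fixes \<phi> :: "'a::{finite,field} \<Rightarrow> 'b::field"
  assumes "field_hom \<phi>" and "r \<notin> range \<phi>" and "r ^ 2 = \<phi> s" and "(2::'b) \<noteq> 0"
  shows "(\<Sum>x\<in>UNIV. 1 / (x ^ 2 - s)) \<noteq> 0"
proof
  assume 0: "(\<Sum>x\<in>UNIV. 1 / (x ^ 2 - s)) = 0"
  interpret field_hom \<phi> by fact
  have nz1: "r - \<phi> x \<noteq> 0" for x using assms(2) by auto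
  have nz2: "r + \<phi> x \<noteq> 0" for x using nz1[of "- x"] by (simp add: hom_uminus)
  have "2 * (\<Sum>x\<in>UNIV. 1 / (r - \<phi> x)) = (\<Sum>x\<in>UNIV. 1 / (r - \<phi> x) + 1 / (r - \<phi> (- x)))"
    by (rule sum_reflect_double)
  also have "\<dots> = (\<Sum>x\<in>UNIV. (- 2 * r) * \<phi> (1 / (x ^ 2 - s)))"
  proof (rule sum.cong)
    fix x
    have "\<phi> (1 / (x ^ 2 - s)) = 1 / ((\<phi> x) ^ 2 - r ^ 2)"
      by (simp add: hom_div hom_minus hom_power assms(3))
    also have "(\<phi> x) ^ 2 - r ^ 2 = - ((r - \<phi> x) * (r + \<phi> x))"
      by (simp add: algebra_simps power2_eq_square)
    finally have "(- 2 * r) * \<phi> (1 / (x ^ 2 - s)) = 2 * r / ((r - \<phi> x) * (r + \<phi> x))" by simp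
    also have "\<dots> = 1 / (r - \<phi> x) + 1 / (r + \<phi> x)"
      using nz1[of x] nz2[of x] by (simp add: add_frac_eq)
    finally show "1 / (r - \<phi> x) + 1 / (r - \<phi> (- x)) = (- 2 * r) * \<phi> (1 / (x ^ 2 - s))"
      by (simp add: hom_uminus)
  qed simp
  also have "\<dots> = (- 2 * r) * \<phi> (\<Sum>x\<in>UNIV. 1 / (x ^ 2 - s))"
    by (simp add: hom_sum sum_distrib_left)
  also have "\<dots> = 0" by (simp add: 0)
  finally have "2 * (\<Sum>x\<in>UNIV. 1 / (r - \<phi> x)) = 0" .
  then have "(2::'b) = 0" using sum_inverse_diff_nonzero[OF assms(1,2)] by simp
  with assms(4) show False by simp
qed

section \<open>The second and third power sums of \<open>F\<close>\<close>

lemma sums_of_squares_and_cubes: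
  fixes a b s :: "'a::{finite,field}"
  defines "u \<equiv> \<lambda>x. 1 / (x ^ 2 - s)"
  defines "F \<equiv> \<lambda>x. a * x ^ 2 + b * x + 2 * x * u x"
  assumes "CARD('a) > 7" and "(2::'a) \<noteq> 0" and "\<And>x. x ^ 2 \<noteq> s"
    and "(\<Sum>x\<in>UNIV. F x ^ 2) = 0"
  shows "(\<Sum>x\<in>UNIV. F x ^ 3) = 12 * a * s * (\<Sum>x\<in>UNIV. u x)"
proof -
  define T where "T = (\<Sum>x\<in>UNIV. u x)"
  define W where "W = (\<Sum>x\<in>UNIV. u x ^ 2)"
  have u: "x ^ 2 * u x = 1 + s * u x" for x
    using assms(5)[of x] by (simp add: u_def field_simps)
  have u_minus: "u (- x) = u x" for x by (simp add: u_def)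
  \<comment> \<open>The exponent 6 is where \<open>q > 7\<close> is sharp: it requires
    \<open>6 < q - 1\<close>.\<close>
  have pow: "(\<Sum>x::'a\<in>UNIV. x ^ 2) = 0" "(\<Sum>x::'a\<in>UNIV. x ^ 4) = 0" "(\<Sum>x::'a\<in>UNIV. x ^ 6) = 0"
    using assms(3) by (simp_all add: sum_power_finite_field)
  have const: "(\<Sum>x::'a\<in>UNIV. k) = 0" for k :: 'a
    using sum_distrib_left[of k "\<lambda>_. 1" "UNIV::'a set"]
    by (simp add: sum_one_finite_ring del: sum_constant)
  have "2 * (\<Sum>x\<in>UNIV. F x ^ 2) = (\<Sum>x\<in>UNIV. F x ^ 2 + F (- x) ^ 2)"
    by (rule sum_reflect_double)
  also have "\<dots> = (\<Sum>x\<in>UNIV. 2 * a ^ 2 * x ^ 4 + 2 * b ^ 2 * x ^ 2 + 8 * b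
      + (8 * b * s + 8) * u x + 8 * s * u x ^ 2)"
  proof (rule sum.cong)
    fix x
    \<comment> \<open>The even terms are grouped around \<open>x ^ 2 * u x\<close>, which the fact
      \<open>u\<close> makes linear in \<open>u x\<close>.\<close>
    have "F x ^ 2 + F (- x) ^ 2 = 2 * a ^ 2 * x ^ 4 + 2 * b ^ 2 * x ^ 2
      + 8 * b * (x ^ 2 * u x) + 8 * (x ^ 2 * u x) * u x"
      unfolding F_def u_minus by (simp add: eval_nat_numeral algebra_simps)
    then show "F x ^ 2 + F (- x) ^ 2 = 2 * a ^ 2 * x ^ 4 + 2 * b ^ 2 * x ^ 2 + 8 * b
      + (8 * b * s + 8) * u x + 8 * s * u x ^ 2"
      unfolding u by (simp add: algebra_simps power2_eq_square)
  qed simp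
  also have "\<dots> = (8 * b * s + 8) * T + 8 * s * W"
    by (simp add: sum.distrib pow const T_def W_def flip: sum_distrib_left del: sum_constant)
  finally have *: "(8 * b * s + 8) * T + 8 * s * W = 0" using assms(6) by simp
  have "2 * (\<Sum>x\<in>UNIV. F x ^ 3) = (\<Sum>x\<in>UNIV. F x ^ 3 + F (- x) ^ 3)"
    by (rule sum_reflect_double)
  also have "\<dots> = (\<Sum>x\<in>UNIV. 2 * a ^ 3 * x ^ 6 + 6 * a * b ^ 2 * x ^ 4 + 24 * a * b * x ^ 2
      + 24 * a * (b * s + 1) + 24 * a * (b * s ^ 2 + 2 * s) * u x + 24 * a * s ^ 2 * u x ^ 2)"
  proof (rule sum.cong)
    fix x
    have "F x ^ 3 + F (- x) ^ 3 = 2 * a ^ 3 * x ^ 6 + 6 * a * b ^ 2 * x ^ 4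
      + 24 * a * b * (x ^ 2 * (x ^ 2 * u x)) + 24 * a * (x ^ 2 * u x) ^ 2"
      unfolding F_def u_minus by (simp add: eval_nat_numeral algebra_simps)
    also have "x ^ 2 * (x ^ 2 * u x) = x ^ 2 + s * (x ^ 2 * u x)"
      by (subst (1) u) (simp add: algebra_simps)
    finally show "F x ^ 3 + F (- x) ^ 3 = 2 * a ^ 3 * x ^ 6 + 6 * a * b ^ 2 * x ^ 4 + 24 * a * b * x ^ 2
      + 24 * a * (b * s + 1) + 24 * a * (b * s ^ 2 + 2 * s) * u x + 24 * a * s ^ 2 * u x ^ 2"
      unfolding u by (simp add: algebra_simps power2_eq_square)
  qed simp
  also have "\<dots> = 24 * a * (b * s ^ 2 + 2 * s) * T + 24 * a * s ^ 2 * W"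
    by (simp add: sum.distrib pow const T_def W_def flip: sum_distrib_left del: sum_constant)
  also have "\<dots> = 2 * (12 * a * s * T)" proof -
    \<comment> \<open>The multiplier \<open>3 * a * s\<close> matches the coefficient
      \<open>24 * a * s ^ 2\<close> of \<open>W\<close>, so the relation from the squares eliminates
      \<open>W\<close>.\<close>
    have "\<dots> = 3 * a * s * ((8 * b * s + 8) * T + 8 * s * W) + 2 * (12 * a * s * T)"
      by (simp add: algebra_simps power2_eq_square)
    then show ?thesis by (simp add: *)
  qed
  finally show ?thesis unfolding T_def mult_left_cancel[OF assms(4)] .
qed

section \<open>From the rational function to a bijection of the affine line\<close>

lemma coprime_num_denom:
  fixes a b s :: "'a::field"
  assumes "2 * s \<noteq> 0"
  shows "coprime ([:0, b, a:] * [:- s, 0, 1:] + [:0, 2:]) [:- s, 0, 1:]" (is "coprime ?p ?q")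
proof (rule coprimeI)
  fix d assume d: "d dvd ?p" "d dvd ?q"
  \<comment> \<open>A Bezout identity: modulo the denominator, \<open>X\<close> times the numerator
    is \<open>2 X^2\<close>, hence \<open>2 s\<close>.\<close>
  have "[:2 * s:] = [:0, 1:] * ?p - ([:0, 1:] * [:0, b, a:] + [:2:]) * ?q"
    by (simp add: algebra_simps)
  also have "d dvd \<dots>" using d by (intro dvd_diff dvd_mult)
  finally have "d dvd [:2 * s:]" .
  moreover have "[:2 * s:] dvd 1" using assms by (simp add: is_unit_pCons_iff)
  ultimately show "is_unit d" by (rule dvd_trans)
qed

lemma bij_affine_part:
  assumes "bij g" "g Infinity = Infinity" "\<And>x. g (Affine x) = Affine (F x)"
  shows "bij F"
proof (rule bijI)
  show "inj F" using assms(1,3) by (metis bij_is_inj injD injI proj_line.inject)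
  show "surj F"
    unfolding surj_def
  proof
    fix y
    obtain z where "g z = Affine y" using assms(1) by (metis bij_pointE)
    then show "\<exists>x. y = F x" using assms(2,3) by (cases z) auto
  qed
qed

lemma ratfun_over_subfield_eq:
  fixes \<phi> :: "'a::field \<Rightarrow> 'b::field" and a b :: 'a and r :: 'b
  assumes "field_hom \<phi>" and "r ^ 2 = \<phi> s"
    and f: "map_fract (map_poly \<phi>) f =
           ratfun_const (\<phi> a) * ratfun_X ^ 2 + ratfun_const (\<phi> b) * ratfun_X
           + 1 / (ratfun_X - ratfun_const r) + 1 / (ratfun_X + ratfun_const r)"
  shows "f = Fract ([:0, b, a:] * [:- s, 0, 1:] + [:0, 2:]) [:- s, 0, 1:]" (is "f = ?g")
proof -
  interpret field_hom \<phi> by fact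
  interpret h: map_poly_inj_idom_hom \<phi> ..
  define u v where "u = [:-r, 1:]" and "v = [:r, 1:]"
  have q: "map_poly \<phi> [:- s, 0, 1:] = u * v"
    by (simp add: u_def v_def hom_uminus assms(2)[symmetric] power2_eq_square)
  \<comment> \<open>\<open>2 X\<close> is the numerator of \<open>1 / u + 1 / v\<close> over the
    common denominator \<open>u * v\<close>.\<close>
  have "map_poly \<phi> [:0, 2:] = u + v"
    by (simp add: u_def v_def map_poly_pCons_hom hom_numeral numeral_poly)
  then have p: "map_poly \<phi> ([:0, b, a:] * [:- s, 0, 1:] + [:0, 2:]) =
      [:0, \<phi> b, \<phi> a:] * (u * v) + (u + v)"
    unfolding h.hom_add h.hom_mult q by (simp add: map_poly_pCons_hom)
  have nz: "to_fract u \<noteq> 0" "to_fract v \<noteq> 0" by (simp_all add: u_def v_def)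
  have "map_fract (map_poly \<phi>) ?g = Fract ([:0, \<phi> b, \<phi> a:] * (u * v) + (u + v)) (u * v)"
    by (subst h.map_fract_Fract) (simp_all only: p q, simp)
  also have "\<dots> = to_fract [:0, \<phi> b, \<phi> a:] + 1 / to_fract u + 1 / to_fract v"
  proof -
    have "(A * (to_fract u * to_fract v) + (to_fract u + to_fract v)) / (to_fract u * to_fract v)
        = A + 1 / to_fract u + 1 / to_fract v" for A
      using nz by (simp add: field_simps)
    then show ?thesis by (simp only: Fract_conv_to_fract to_fract_add to_fract_mult)
  qed
  also have "to_fract [:0, \<phi> b, \<phi> a:] =
      ratfun_const (\<phi> a) * ratfun_X ^ 2 + ratfun_const (\<phi> b) * ratfun_X"
    by (simp add: ratfun_const_def ratfun_X_def power2_eq_square flip: to_fract_mult to_fract_add)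
  also have "to_fract u = ratfun_X - ratfun_const r"
    by (simp add: ratfun_const_def ratfun_X_def u_def flip: to_fract_diff)
  also have "to_fract v = ratfun_X + ratfun_const r"
    by (simp add: ratfun_const_def ratfun_X_def v_def flip: to_fract_add)
  \<comment> \<open>\<open>?g\<close> satisfies the equation that defines \<open>f\<close>;
    uniqueness of the solution identifies them.\<close>
  finally show ?thesis using ex1_ratfun_over_subfield[OF assms(1), of r a b] assms(2) f by (metis rangeI)
qed

theorem theorem4p2:
  fixes \<phi> :: "'a::finite_field \<Rightarrow> 'b::finite_field"
    and a b :: 'a and r :: 'b
    and f :: "'a poly fract"
  assumes "CHAR('a) \<noteq> 2" and "CHAR('a) \<noteq> 3" and "CARD('a) > 7"
    and "field_hom \<phi>" and "CARD('b) = CARD('a) ^ 2"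
    and "a \<noteq> 0" and "r \<notin> range \<phi>" and "r ^ 2 \<in> range \<phi>"
    and "map_fract (map_poly \<phi>) f =
           ratfun_const (\<phi> a) * ratfun_X ^ 2 + ratfun_const (\<phi> b) * ratfun_X
           + 1 / (ratfun_X - ratfun_const r) + 1 / (ratfun_X + ratfun_const r)"
  shows "\<not> permutation_ratfun f"
proof
  assume perm: "permutation_ratfun f"
  interpret field_hom \<phi> by fact
  from assms(8) obtain s where s: "r ^ 2 = \<phi> s" by blast
  define u where "u x = 1 / (x ^ 2 - s)" for x
  define F where "F x = a * x ^ 2 + b * x + 2 * x * u x" for x
  have prime_nz: "of_nat p \<noteq> (0::'a)" if "prime p" "CHAR('a) \<noteq> p" for p
    using that by (auto simp: of_nat_eq_0_iff_char_dvd prime_nat_iff)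
  have two: "(2::'a) \<noteq> 0" and three: "(3::'a) \<noteq> 0"
    using prime_nz[of 2] prime_nz[of 3] assms(1,2) by auto
  have two': "(2::'b) \<noteq> 0" using two hom_0_iff[of 2] by (simp add: hom_numeral)
  have s_nz: "s \<noteq> 0"
  proof
    assume "s = 0"
    then have "r = \<phi> 0" using s by simp
    then show False using assms(7) by blast
  qed
  have nonsq: "x ^ 2 \<noteq> s" for x
  proof
    assume "x ^ 2 = s"
    then have "r = \<phi> x \<or> r = \<phi> (- x)"
      using s by (auto simp: hom_power hom_uminus power2_eq_iff)
    then show False using assms(7) by auto
  qed
  define p where "p = [:0, b, a:] * [:- s, 0, 1:] + [:0, 2:]"
  have "f = Fract p [:- s, 0, 1:]"
    unfolding p_def by (rule ratfun_over_subfield_eq[OF assms(4) s assms(9)])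
  moreover have "coprime p [:- s, 0, 1:]"
    unfolding p_def by (rule coprime_num_denom) (use two s_nz in simp)
  ultimately have bij: "bij (quotient_map p [:- s, 0, 1:])"
    using perm by (simp add: permutation_ratfun_def ratfun_map_Fract)
  \<comment> \<open>With \<open>a \<noteq> 0\<close> the numerator outgrows the quadratic
    denominator, so infinity is fixed.\<close>
  have "degree p = 4" using assms(6) by (simp add: p_def)
  have "bij F"
  proof (rule bij_affine_part[OF bij])
    show "quotient_map p [:- s, 0, 1:] Infinity = Infinity" using \<open>degree p = 4\<close> by simp
    show "quotient_map p [:- s, 0, 1:] (Affine x) = Affine (F x)" for x
    proof -
      have "x * x - s \<noteq> 0" using nonsq[of x] by (simp add: power2_eq_square)
      then show ?thesis
        by (simp add: p_def F_def u_def power2_eq_square field_simps)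
    qed
  qed
  \<comment> \<open>A bijective \<open>F\<close> only permutes the summands of a power sum.\<close>
  then have sums: "(\<Sum>x\<in>UNIV. F x ^ k) = 0" if "0 < k" "k < CARD('a) - 1" for k
    using sum.reindex_bij_betw[of F UNIV UNIV "\<lambda>y. y ^ k"] sum_power_finite_field[OF that]
    by simp
  have "12 * a * s * (\<Sum>x\<in>UNIV. u x) = (\<Sum>x\<in>UNIV. F x ^ 3)"
    unfolding F_def u_def
    by (rule sums_of_squares_and_cubes[symmetric])
      (use assms(3) two nonsq sums[of 2] in \<open>simp_all add: F_def u_def\<close>)
  also have "\<dots> = 0" using assms(3) by (intro sums) auto
  finally have "12 * a * s * (\<Sum>x\<in>UNIV. u x) = 0" .
  \<comment> \<open>Characteristic other than 2 and 3 makes the factor 12 invertible.\<close>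
  moreover have "(12::'a) = 2 * 2 * 3" by simp
  then have "(12::'a) \<noteq> 0" using two three by (metis mult_eq_0_iff)
  moreover have "(\<Sum>x\<in>UNIV. u x) \<noteq> 0"
    unfolding u_def by (rule sum_inverse_square_diff_nonzero[OF assms(4,7) s two'])
  ultimately show False using assms(6) s_nz by simp
qed

end
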